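(* Let $(x^k,u^k)_{k\ge0}$ be generated by Algorithm (DG). Then the last primal iterate $u^k$ is an $\epsilon$-primal solution of (P) after $k=\mathcal{O}(1/\epsilon^2)$ iterations; that is, there exist constants $C_1,C_2>0$, independent of $\epsilon$ and $k$, such that for every $\epsilon>0$ and every integer $k\ge 1$ with $k \ge C_1/\epsilon^2$, $$\mathrm{dist}_{\mathcal{K}}(Gu^k+g)\le C_2\,\epsilon \quad\text{and}\quad -C_2\,\epsilon\le f(u^k)-f^*\le C_2\,\epsilon .$$
   Context: Problem (P): $f^* = \min_{u \in U} f(u)$ subject to $Gu + g \in \mathcal{K}$, where $f:\mathbb{R}^n \to \mathbb{R}$ is $\sigma_{\mathrm f}$-strongly convex with respect to the Euclidean norm $\|\cdot\|$ ($\sigma_{\mathrm f}>0$), $G \in \mathbb{R}^{p\times n}$ ($G\ne 0$), $g \in \mathbb{R}^p$, $\mathcal{K}\subseteq\mathbb{R}^p$ is a proper cone (closed, convex, pointed, nonempty interior), and $U \subseteq \mathbb{R}^n$ is a nonempty closed convex set. $\mathcal{K}^* = \{x : \langle x,z\rangle \ge 0\ \forall z\in\mathcal{K}\}$ is the dual cone. The Lagrangian is $\mathcal{L}(u,x) = f(u) - \langle x, Gu+g\rangle$, the dual function is $d(x) = \min_{u\in U}\mathcal{L}(u,x)$ for $x \in \mathbb{R}^p$, and $u(x)$ is the unique minimizer of $\mathcal{L}(\cdot,x)$ over $U$. The function $d$ is concave and differentiable with $\nabla d(x) = -Gu(x)-g$, Lipschitz with constant $L_{\mathrm d} = \|G\|^2/\sigma_{\mathrm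 f}$ ($\|G\|$ the spectral norm). Standing assumption: there exists a finite optimal Lagrange multiplier for the conic constraint, so that $f^* = \max_{x\in\mathcal{K}^*} d(x)$ and the set $X^*\subseteq\mathcal{K}^*$ of maximizers is nonempty. $[z]_C$ denotes Euclidean projection onto $C$ and $\mathrm{dist}_C(z)=\min_{w\in C}\|w-z\|$. Algorithm (DG): given $x^0\in\mathcal{K}^*$, for $k\ge 0$ compute $u^k = u(x^k)=\arg\min_{u\in U}\mathcal{L}(u,x^k)$ and $x^{k+1} = [x^k + \alpha_k\nabla d(x^k)]_{\mathcal{K}^*}$, where the step sizes satisfy $\frac{1}{L_G}\le\alpha_k\le\frac{1}{L_{\mathrm d}}$ for a constant $L_G\ge L_{\mathrm d}$. $\tilde u\in U$ is an $\epsilon$-primal solution if $\mathrm{dist}_{\mathcal{K}}(G\tilde u+g)\le\mathcal{O}(\epsilon)$ and $-\mathcal{O}(\epsilon)\le f(\tilde u)-f^*\le\mathcal{O}(\epsilon)$; constants in $\mathcal{O}$ may depend on the problem data, $x^0$ and $L_G$, but not on $\epsilon$ or $k$. *)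

theory Defs
  imports "HOL-Analysis.Analysis"
begin

definition strongly_convex :: "real \<Rightarrow> ('a::real_inner \<Rightarrow> real) \<Rightarrow> bool" where
  "strongly_convex \<sigma> f \<longleftrightarrow>
     (\<forall>x y. \<forall>t\<in>{0..1}. f (t *\<^sub>R x + (1 - t) *\<^sub>R y)
        \<le> t * f x + (1 - t) * f y - \<sigma> / 2 * t * (1 - t) * (norm (x - y))\<^sup>2)"

definition proper_cone :: "'a::real_normed_vector set \<Rightarrow> bool" where
  "proper_cone K \<longleftrightarrow> closed K \<and> convex_cone K \<and> interior K \<noteq> {} \<and>
     (\<forall>z. z \<in> K \<and> - z \<in> K \<longrightarrow> z = 0)"

definition dual_cone :: "'a::real_inner set \<Rightarrow> 'a set" where
  "dual_cone K = {x. \<forall>z\<in>K. x \<bullet> z \<ge> 0}"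

(* Meaningful only where f is differentiable, since THE is otherwise unspecified. *)
definition grad :: "('a::real_inner \<Rightarrow> real) \<Rightarrow> 'a \<Rightarrow> 'a" where
  "grad f x = (THE D. GDERIV f x :> D)"

definition feasible_set ::
  "real^'n^'p \<Rightarrow> real^'p \<Rightarrow> (real^'p) set \<Rightarrow> (real^'n) set \<Rightarrow> (real^'n) set" where
  "feasible_set G g K U = {u \<in> U. G *v u + g \<in> K}"

(* For strongly convex f and nonempty closed convex U, both infima below are attained
   (for the first one, when the feasible set of the closed convex cone K is nonempty),
   so they are the minima of the primal problem and of the Lagrangian. *)
definition opt_val ::
  "(real^'n \<Rightarrow> real) \<Rightarrow> real^'n^'p \<Rightarrow> real^'p \<Rightarrow> (real^'p) set \<Rightarrow> (real^'n) set \<Rightarrow> real" where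
  "opt_val f G g K U = (INF u\<in>feasible_set G g K U. f u)"

definition lagrangian ::
  "(real^'n \<Rightarrow> real) \<Rightarrow> real^'n^'p \<Rightarrow> real^'p \<Rightarrow> real^'n \<Rightarrow> real^'p \<Rightarrow> real" where
  "lagrangian f G g u x = f u - x \<bullet> (G *v u + g)"

definition dual_fun ::
  "(real^'n \<Rightarrow> real) \<Rightarrow> real^'n^'p \<Rightarrow> real^'p \<Rightarrow> (real^'n) set \<Rightarrow> real^'p \<Rightarrow> real" where
  "dual_fun f G g U x = (INF u\<in>U. lagrangian f G g u x)"

definition dual_solutions ::
  "(real^'n \<Rightarrow> real) \<Rightarrow> real^'n^'p \<Rightarrow> real^'p \<Rightarrow> (real^'p) set \<Rightarrow> (real^'n) set \<Rightarrow> (real^'p) set" where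
  "dual_solutions f G g K U = {x. is_arg_max (dual_fun f G g U) (\<lambda>y. y \<in> dual_cone K) x}"

(* The spectral norm is the operator norm; norm on real^'n^'p would be the Frobenius norm. *)
definition dual_lipschitz :: "real \<Rightarrow> real^'n^'p \<Rightarrow> real" where
  "dual_lipschitz \<sigma> G = (onorm ((*v) G))\<^sup>2 / \<sigma>"

definition DG_iterates ::
  "(real^'n \<Rightarrow> real) \<Rightarrow> real \<Rightarrow> real^'n^'p \<Rightarrow> real^'p \<Rightarrow> (real^'p) set \<Rightarrow> (real^'n) set \<Rightarrow> real \<Rightarrow> real^'p
     \<Rightarrow> (nat \<Rightarrow> real) \<Rightarrow> (nat \<Rightarrow> real^'p) \<Rightarrow> (nat \<Rightarrow> real^'n) \<Rightarrow> bool" where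
  "DG_iterates f \<sigma> G g K U LG x0 \<alpha> x u \<longleftrightarrow>
     x 0 = x0 \<and>
     (\<forall>k. 1 / LG \<le> \<alpha> k \<and> \<alpha> k \<le> 1 / dual_lipschitz \<sigma> G) \<and>
     (\<forall>k. is_arg_min (\<lambda>v. lagrangian f G g v (x k)) (\<lambda>v. v \<in> U) (u k)) \<and>
     (\<forall>k. x (Suc k) =
        closest_point (dual_cone K) (x k + \<alpha> k *\<^sub>R grad (dual_fun f G g U) (x k)))"

(* C is the constant hidden in the O-notation for the accuracy \<epsilon>. *)
definition primal_solution ::
  "(real^'n \<Rightarrow> real) \<Rightarrow> real^'n^'p \<Rightarrow> real^'p \<Rightarrow> (real^'p) set \<Rightarrow> (real^'n) set
     \<Rightarrow> real \<Rightarrow> real \<Rightarrow> real^'n \<Rightarrow> bool" where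
  "primal_solution f G g K U C \<epsilon> v \<longleftrightarrow>
     v \<in> U \<and> infdist (G *v v + g) K \<le> C * \<epsilon> \<and>
     - (C * \<epsilon>) \<le> f v - opt_val f G g K U \<and> f v - opt_val f G g K U \<le> C * \<epsilon>"

end

theory Submission
  imports Defs
begin

text \<open>
  Write \<open>d\<close> for the dual function, \<open>w\<^sub>k = G u\<^sup>k + g\<close>, and fix an optimal multiplier \<open>x*\<close>, so that
  \<open>f* = d(x*)\<close>. Everything rests on one inequality: the Lagrangian is \<open>\<sigma>\<close>-strongly convex in its
  primal argument, so it grows quadratically away from its minimizer over \<open>U\<close>
  (\<open>strongly_convex_arg_min_growth\<close>). It is used twice.

  On the dual side, it shows that \<open>- w\<^sub>k\<close> is a supergradient of \<open>d\<close> at \<open>x\<^sup>k\<close> and that \<open>d\<close> lies above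
  the tangent there up to the error \<open>L\<^sub>d/2 \<parallel>y - x\<^sup>k\<parallel>\<^sup>2\<close> (\<open>dual_fun_le_tangent\<close>,
  \<open>dual_fun_ge_tangent\<close>). These two bounds identify the gradient, and they are all that the analysis
  of projected gradient ascent needs: each step satisfies
  \<open>2 \<alpha>\<^sub>k (d(x*) - d(x\<^sup>k\<^sup>+\<^sup>1)) \<le> \<parallel>x* - x\<^sup>k\<parallel>\<^sup>2 - \<parallel>x* - x\<^sup>k\<^sup>+\<^sup>1\<parallel>\<^sup>2\<close>, which telescopes to
  \<open>d(x*) - d(x\<^sup>k) \<le> L\<^sub>G \<parallel>x* - x\<^sup>0\<parallel>\<^sup>2 / (2k)\<close> with the iterates bounded
  (\<open>projected_ascent_rate\<close>).

  On the primal side, a feasible \<open>v\<close> has \<open>\<L>(v, x\<^sup>k) \<le> f(v)\<close>, so growth around \<open>u\<^sup>k\<close> gives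
  \<open>\<sigma>/2 \<parallel>v - u\<^sup>k\<parallel>\<^sup>2 \<le> f(v) - d(x\<^sup>k)\<close>. With \<open>v\<close> almost optimal and \<open>k\<close> of order \<open>1/\<epsilon>\<^sup>2\<close> the right side
  is of order \<open>\<epsilon>\<^sup>2\<close>, hence \<open>u\<^sup>k\<close> is within order \<open>\<epsilon>\<close> of a feasible, almost optimal point; the square
  root taken here is what turns the dual rate \<open>1/k\<close> into the primal complexity \<open>1/\<epsilon>\<^sup>2\<close>. Feasibility
  of \<open>u\<^sup>k\<close> follows because \<open>G\<close> is bounded, the lower bound on \<open>f(u\<^sup>k)\<close> from
  \<open>d(x*) \<le> \<L>(u\<^sup>k, x*)\<close>, and the upper bound from \<open>\<L>(u\<^sup>k, x\<^sup>k) \<le> \<L>(v, x\<^sup>k)\<close>. Approximating the infimum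
  by almost optimal points \<open>v\<close> avoids having to prove that (P) attains its minimum.
\<close>

section \<open>Strong convexity and gradients\<close>

lemma strongly_convex_add_affine:
  fixes f :: "'a::real_inner \<Rightarrow> real"
  assumes "strongly_convex \<sigma> f"
    and affine: "\<And>x y t. l (t *\<^sub>R x + (1 - t) *\<^sub>R y) = t * l x + (1 - t) * l y"
  shows "strongly_convex \<sigma> (\<lambda>x. f x + l x)"
  unfolding strongly_convex_def
proof (intro allI ballI)
  fix x y and t :: real
  assume t: "t \<in> {0..1}"
  have "f (t *\<^sub>R x + (1 - t) *\<^sub>R y)
      \<le> t * f x + (1 - t) * f y - \<sigma> / 2 * t * (1 - t) * (norm (x - y))\<^sup>2"
    using assms(1) t unfolding strongly_convex_def by blast
  then show "f (t *\<^sub>R x + (1 - t) *\<^sub>R y) + l (t *\<^sub>R x + (1 - t) *\<^sub>R y)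
      \<le> t * (f x + l x) + (1 - t) * (f y + l y) - \<sigma> / 2 * t * (1 - t) * (norm (x - y))\<^sup>2"
    unfolding affine by (simp add: algebra_simps)
qed

text \<open>
  Comparing the minimizer \<open>u\<close> with the point \<open>t v + (1 - t) u\<close> of the segment to \<open>v\<close> and dividing by
  \<open>t\<close> leaves the claim with the factor \<open>1 - t\<close> in front of the quadratic term; then \<open>t \<rightarrow> 0\<close>.
\<close>
lemma strongly_convex_arg_min_growth:
  fixes h :: "'a::real_inner \<Rightarrow> real"
  assumes sc: "strongly_convex \<sigma> h" and "convex U"
    and min: "is_arg_min h (\<lambda>v. v \<in> U) u" and v: "v \<in> U"
  shows "h u + \<sigma> / 2 * (norm (v - u))\<^sup>2 \<le> h v"
proof -
  have u: "u \<in> U" and le: "\<And>w. w \<in> U \<Longrightarrow> h u \<le> h w"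
    using min unfolding is_arg_min_def by (auto simp: not_less)
  let ?q = "\<sigma> / 2 * (norm (v - u))\<^sup>2"
  have *: "h u + (1 - t) * ?q \<le> h v" if t: "0 < t" "t < 1" for t :: real
  proof -
    have "t *\<^sub>R v + (1 - t) *\<^sub>R u \<in> U"
      using \<open>convex U\<close> u v t by (simp add: convex_def)
    then have "h u \<le> h (t *\<^sub>R v + (1 - t) *\<^sub>R u)"
      by (rule le)
    also have "\<dots> \<le> t * h v + (1 - t) * h u - \<sigma> / 2 * t * (1 - t) * (norm (v - u))\<^sup>2"
      using sc t unfolding strongly_convex_def by simp
    finally have "t * (h u + (1 - t) * ?q) \<le> t * h v"
      by (simp add: algebra_simps)
    then show ?thesis
      using t by simp
  qed
  have "((\<lambda>t. h u + (1 - t) * ?q) \<longlongrightarrow> h u + (1 - 0) * ?q) (at_right 0)"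
    by (intro tendsto_intros)
  moreover have "eventually (\<lambda>t. h u + (1 - t) * ?q \<le> h v) (at_right 0)"
    using eventually_at_right_less[of 0] eventually_at_right_real[of 0 1]
    by (rule eventually_elim2) (use * in auto)
  ultimately show ?thesis
    using tendsto_upperbound[of "\<lambda>t. h u + (1 - t) * ?q" _ "at_right 0" "h v"] by simp
qed

lemma grad_eqI:
  assumes "GDERIV f x :> D"
  shows "grad f x = D"
  unfolding grad_def
proof (rule the_equality)
  fix E assume "GDERIV f x :> E"
  then have "(\<lambda>h. h \<bullet> E) = (\<lambda>h. h \<bullet> D)"
    using assms unfolding gderiv_def by (rule has_derivative_unique)
  then show "E = D"
    by (metis inner_commute vector_eq_rdot)
qed (fact assms)

lemma GDERIV_of_quadratic_error:
  fixes f :: "'a::real_inner \<Rightarrow> real"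
  assumes err: "\<And>y. \<bar>f y - f x - D \<bullet> (y - x)\<bar> \<le> c * (norm (y - x))\<^sup>2"
  shows "GDERIV f x :> D"
  unfolding gderiv_def has_derivative_at_within
proof
  show "bounded_linear (\<lambda>h. h \<bullet> D)"
    by (rule bounded_linear_inner_left)
  show "((\<lambda>y. (f y - f x - (y - x) \<bullet> D) /\<^sub>R norm (y - x)) \<longlongrightarrow> 0) (at x)"
  proof (rule Lim_null_comparison)
    show "\<forall>\<^sub>F y in at x. norm ((f y - f x - (y - x) \<bullet> D) /\<^sub>R norm (y - x)) \<le> c * norm (y - x)"
    proof (intro eventually_at_filter[THEN iffD2] always_eventually allI impI)
      fix y assume "y \<noteq> x"
      then show "norm ((f y - f x - (y - x) \<bullet> D) /\<^sub>R norm (y - x)) \<le> c * norm (y - x)"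
        using err[of y]
        by (simp add: inner_commute abs_mult divide_inverse[symmetric] field_simps power2_eq_square)
    qed
    have "((\<lambda>y. c * norm (y - x)) \<longlongrightarrow> c * norm (x - x)) (at x)"
      by (intro tendsto_intros)
    then show "((\<lambda>y. c * norm (y - x)) \<longlongrightarrow> 0) (at x)"
      by simp
  qed
qed

section \<open>Projected gradient ascent\<close>

text \<open>
  The projection inequality bounds the component of \<open>s\<close> along \<open>y - x'\<close> by the step
  \<open>(x' - x) / \<alpha>\<close>; the loss from the quadratic error is absorbed by \<open>L \<le> 1 / \<alpha>\<close>, and the
  law of cosines turns the sum into a difference of squared distances.
\<close>
lemma projected_ascent_step:
  fixes d :: "'a::euclidean_space \<Rightarrow> real"
  assumes C: "closed C" "convex C" and y: "y \<in> C"
    and \<alpha>: "0 < \<alpha>" "\<alpha> * L \<le> 1"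
    and x': "x' = closest_point C (x + \<alpha> *\<^sub>R s)"
    and upper: "d y \<le> d x + s \<bullet> (y - x)"
    and lower: "d x + s \<bullet> (x' - x) - L / 2 * (norm (x' - x))\<^sup>2 \<le> d x'"
  shows "2 * \<alpha> * (d y - d x') \<le> (norm (y - x))\<^sup>2 - (norm (y - x'))\<^sup>2"
proof -
  have "(x + \<alpha> *\<^sub>R s - x') \<bullet> (y - x') \<le> 0"
    unfolding x' using C y by (intro closest_point_dot)
  then have proj: "\<alpha> * (s \<bullet> (y - x')) \<le> (x' - x) \<bullet> (y - x')"
    by (simp add: inner_diff_left inner_add_left)
  have "d y - d x' \<le> s \<bullet> (y - x') + L / 2 * (norm (x' - x))\<^sup>2"
    using upper lower by (simp add: inner_diff_right)
  then have "2 * \<alpha> * (d y - d x') \<le> 2 * \<alpha> * (s \<bullet> (y - x') + L / 2 * (norm (x' - x))\<^sup>2)"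
    using \<alpha> by (intro mult_left_mono) auto
  also have "\<dots> = 2 * (\<alpha> * (s \<bullet> (y - x'))) + (\<alpha> * L) * (norm (x' - x))\<^sup>2"
    by (simp add: algebra_simps)
  also have "\<dots> \<le> 2 * ((x' - x) \<bullet> (y - x')) + 1 * (norm (x' - x))\<^sup>2"
    using proj \<alpha> by (intro add_mono mult_left_mono mult_right_mono) auto
  also have "\<dots> = (norm (y - x))\<^sup>2 - (norm (y - x'))\<^sup>2"
    by (simp add: power2_norm_eq_inner inner_diff_left inner_diff_right inner_commute)
  finally show ?thesis .
qed

text \<open>
  The step inequality with \<open>y\<close> the maximizer telescopes; with \<open>y = x k\<close> it shows that the values
  increase, which transfers the averaged bound to the last iterate.
\<close>
lemma projected_ascent_rate:
  fixes d :: "'a::euclidean_space \<Rightarrow> real"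
  assumes C: "closed C" "convex C" and x0: "x 0 \<in> C"
    and \<alpha>: "\<And>k. 1 / M \<le> \<alpha> k" "\<And>k. \<alpha> k * L \<le> 1" and M: "0 < M"
    and step: "\<And>k. x (Suc k) = closest_point C (x k + \<alpha> k *\<^sub>R s k)"
    and upper: "\<And>k y. d y \<le> d (x k) + s k \<bullet> (y - x k)"
    and lower: "\<And>k y. d (x k) + s k \<bullet> (y - x k) - L / 2 * (norm (y - x k))\<^sup>2 \<le> d y"
    and z: "z \<in> C" and max: "\<And>y. y \<in> C \<Longrightarrow> d y \<le> d z"
  shows "x k \<in> C" and "norm (z - x k) \<le> norm (z - x 0)"
    and "real k * (d z - d (x k)) \<le> M / 2 * (norm (z - x 0))\<^sup>2"
proof -
  have in_C: "x k \<in> C" for k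
    using x0 C by (cases k) (auto simp: step intro!: closest_point_in_set)
  then show "x k \<in> C" .
  have pos: "0 < \<alpha> k" for k
    using M \<alpha>(1)[of k] by (meson divide_pos_pos less_le_trans zero_less_one)
  note ineq = projected_ascent_step[where d = d and C = C, OF C _ pos \<alpha>(2) step upper lower]
  have mono: "d (x k) \<le> d (x (Suc k))" for k
  proof -
    have "2 * \<alpha> k * (d (x k) - d (x (Suc k)))
        \<le> (norm (x k - x k))\<^sup>2 - (norm (x k - x (Suc k)))\<^sup>2"
      using in_C by (rule ineq)
    also have "\<dots> \<le> 0"
      by simp
    finally show ?thesis
      using pos[of k] by (simp add: mult_le_0_iff)
  qed
  have drop: "d z - d (x (Suc k)) \<le> M / 2 * ((norm (z - x k))\<^sup>2 - (norm (z - x (Suc k)))\<^sup>2)" for k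
  proof -
    have "2 * (1 / M) * (d z - d (x (Suc k))) \<le> 2 * \<alpha> k * (d z - d (x (Suc k)))"
      using \<alpha>(1)[of k] max[OF in_C] by (intro mult_right_mono mult_left_mono) auto
    also have "\<dots> \<le> (norm (z - x k))\<^sup>2 - (norm (z - x (Suc k)))\<^sup>2"
      using z by (rule ineq)
    finally show ?thesis
      using M by (simp add: field_simps)
  qed
  have sum: "real k * (d z - d (x k)) \<le> M / 2 * ((norm (z - x 0))\<^sup>2 - (norm (z - x k))\<^sup>2)" for k
  proof (induction k)
    case (Suc k)
    have "real k * (d z - d (x (Suc k))) \<le> real k * (d z - d (x k))"
      using mono[of k] by (intro mult_left_mono) auto
    then show ?case
      using Suc.IH drop[of k] by (simp add: algebra_simps)
  qed simp
  have "0 \<le> real k * (d z - d (x k))"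
    using max[OF in_C] by simp
  then have "0 \<le> M / 2 * ((norm (z - x 0))\<^sup>2 - (norm (z - x k))\<^sup>2)"
    using sum[of k] by linarith
  then have "(norm (z - x k))\<^sup>2 \<le> (norm (z - x 0))\<^sup>2"
    using M by (simp add: zero_le_mult_iff)
  then show "norm (z - x k) \<le> norm (z - x 0)"
    by (rule power2_le_imp_le) simp
  have "M / 2 * ((norm (z - x 0))\<^sup>2 - (norm (z - x k))\<^sup>2) \<le> M / 2 * (norm (z - x 0))\<^sup>2"
    using M by (intro mult_left_mono) auto
  then show "real k * (d z - d (x k)) \<le> M / 2 * (norm (z - x 0))\<^sup>2"
    using sum[of k] by linarith
qed

section \<open>The dual cone and the dual function\<close>

lemma dual_cone_eq_Inter_halfspaces: "dual_cone K = (\<Inter>z\<in>K. {x. z \<bullet> x \<ge> 0})"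
  by (auto simp: dual_cone_def inner_commute)

lemma closed_dual_cone: "closed (dual_cone K)"
  unfolding dual_cone_eq_Inter_halfspaces by (intro closed_INT ballI closed_halfspace_ge)

lemma convex_dual_cone: "convex (dual_cone K)"
  unfolding dual_cone_eq_Inter_halfspaces by (intro convex_INT convex_halfspace_ge)

lemma dual_cone_inner_nonneg: "x \<in> dual_cone K \<Longrightarrow> z \<in> K \<Longrightarrow> 0 \<le> x \<bullet> z"
  by (simp add: dual_cone_def)

lemma dual_cone_inner_ge_infdist:
  fixes K :: "'a::euclidean_space set"
  assumes "x \<in> dual_cone K" and "closed K" and "K \<noteq> {}"
  shows "- (norm x * infdist w K) \<le> x \<bullet> w"
proof -
  obtain z where z: "z \<in> K" "infdist w K = dist w z"
    using infdist_attains_inf[OF assms(2,3)] by blast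
  have "- (norm x * dist w z) \<le> x \<bullet> (w - z)"
    using Cauchy_Schwarz_ineq2[of x "w - z"] by (simp add: dist_norm)
  also have "\<dots> \<le> x \<bullet> w"
    using dual_cone_inner_nonneg[OF assms(1) z(1)] by (simp add: inner_diff_right)
  finally show ?thesis
    by (simp add: z(2))
qed

lemma norm_matrix_vector_mult_le: "norm (G *v v) \<le> onorm ((*v) G) * norm v"
  for G :: "real^'n^'p"
  by (rule onorm) (rule matrix_vector_mul_bounded_linear)

lemma dual_lipschitz_pos:
  fixes G :: "real^'n^'p"
  assumes "0 < \<sigma>" and "G \<noteq> 0"
  shows "0 < dual_lipschitz \<sigma> G"
proof -
  obtain v where "G *v v \<noteq> 0"
    using \<open>G \<noteq> 0\<close> matrix_eq[of G 0] by auto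
  then have "0 < onorm ((*v) G)"
    using onorm_pos_lt[OF matrix_vector_mul_bounded_linear[of G]] by blast
  then show ?thesis
    using \<open>0 < \<sigma>\<close> by (simp add: dual_lipschitz_def)
qed

lemma lagrangian_change_multiplier:
  "lagrangian f G g v y = lagrangian f G g v x - (G *v v + g) \<bullet> (y - x)"
  by (simp add: lagrangian_def inner_diff_right inner_commute[of "G *v v + g"])

lemma strongly_convex_lagrangian:
  fixes f :: "real^'n \<Rightarrow> real" and G :: "real^'n^'p"
  assumes "strongly_convex \<sigma> f"
  shows "strongly_convex \<sigma> (\<lambda>v. lagrangian f G g v x)"
proof -
  have affine: "- (x \<bullet> (G *v (t *\<^sub>R v + (1 - t) *\<^sub>R w) + g))
      = t * - (x \<bullet> (G *v v + g)) + (1 - t) * - (x \<bullet> (G *v w + g))" for t v w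
    by (simp add: matrix_vector_right_distrib matrix_vector_mult_scaleR inner_add_right algebra_simps)
  show ?thesis
    using strongly_convex_add_affine[OF assms affine] by (simp add: lagrangian_def)
qed

lemma lagrangian_growth:
  fixes f :: "real^'n \<Rightarrow> real" and G :: "real^'n^'p"
  assumes "strongly_convex \<sigma> f" and "convex U"
    and "is_arg_min (\<lambda>v. lagrangian f G g v x) (\<lambda>v. v \<in> U) u" and "v \<in> U"
  shows "lagrangian f G g u x + \<sigma> / 2 * (norm (v - u))\<^sup>2 \<le> lagrangian f G g v x"
  using strongly_convex_arg_min_growth[OF strongly_convex_lagrangian[OF assms(1)] assms(2-4)] .

lemma dual_fun_eq_lagrangian:
  assumes "is_arg_min (\<lambda>v. lagrangian f G g v x) (\<lambda>v. v \<in> U) u"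
  shows "dual_fun f G g U x = lagrangian f G g u x"
  unfolding dual_fun_def
  by (rule cInf_eq_minimum) (use assms in \<open>auto simp: is_arg_min_def not_less\<close>)

text \<open>
  Moving the multiplier from \<open>x\<close> to \<open>y\<close> perturbs the Lagrangian by a linear term, whose deviation from
  its value at \<open>u\<close> is at most \<open>\<parallel>G\<parallel> \<parallel>v - u\<parallel> \<parallel>y - x\<parallel>\<close>; by Young's inequality the growth
  \<open>\<sigma>/2 \<parallel>v - u\<parallel>\<^sup>2\<close> around \<open>u\<close> pays for this up to \<open>L\<^sub>d/2 \<parallel>y - x\<parallel>\<^sup>2\<close>. The bound holds for each \<open>v\<close>
  separately and so passes to the infimum, whether or not it is attained at \<open>y\<close>.
\<close>
lemma lagrangian_ge_tangent:
  fixes f :: "real^'n \<Rightarrow> real" and G :: "real^'n^'p"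
  assumes "0 < \<sigma>" and "strongly_convex \<sigma> f" and "convex U"
    and "is_arg_min (\<lambda>v. lagrangian f G g v x) (\<lambda>v. v \<in> U) u" and "v \<in> U"
  shows "dual_fun f G g U x + (- (G *v u + g)) \<bullet> (y - x)
      - dual_lipschitz \<sigma> G / 2 * (norm (y - x))\<^sup>2 \<le> lagrangian f G g v y"
proof -
  let ?N = "onorm ((*v) G)" and ?a = "norm (v - u)" and ?b = "norm (y - x)"
  have "(G *v (v - u)) \<bullet> (y - x) \<le> norm (G *v (v - u)) * ?b"
    by (rule norm_cauchy_schwarz)
  also have "\<dots> \<le> ?N * ?a * ?b"
    by (intro mult_right_mono norm_matrix_vector_mult_le) simp
  also have "\<dots> \<le> \<sigma> / 2 * ?a\<^sup>2 + dual_lipschitz \<sigma> G / 2 * ?b\<^sup>2"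
  proof -
    have "0 \<le> (\<sigma> * ?a - ?N * ?b)\<^sup>2 / (2 * \<sigma>)"
      using \<open>0 < \<sigma>\<close> by simp
    also have "\<dots> = \<sigma> / 2 * ?a\<^sup>2 + dual_lipschitz \<sigma> G / 2 * ?b\<^sup>2 - ?N * ?a * ?b"
      using \<open>0 < \<sigma>\<close> by (simp add: dual_lipschitz_def field_simps power2_eq_square)
    finally show ?thesis by simp
  qed
  finally have young: "(G *v (v - u)) \<bullet> (y - x)
      \<le> \<sigma> / 2 * ?a\<^sup>2 + dual_lipschitz \<sigma> G / 2 * ?b\<^sup>2" .
  have "lagrangian f G g u x + \<sigma> / 2 * ?a\<^sup>2 \<le> lagrangian f G g v x"
    using assms(2-5) by (rule lagrangian_growth)
  moreover have "lagrangian f G g v y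
      = lagrangian f G g v x - (G *v u + g) \<bullet> (y - x) - (G *v (v - u)) \<bullet> (y - x)"
    unfolding lagrangian_change_multiplier[of f G g v y x]
    by (simp add: matrix_vector_mult_diff_distrib inner_add_left inner_diff_left)
  ultimately show ?thesis
    unfolding dual_fun_eq_lagrangian[OF assms(4)] using young by (simp only: inner_minus_left)
qed

text \<open>
  A single multiplier with an attained minimum makes the infimum defining the dual function finite
  everywhere; otherwise \<open>INF\<close> would carry no information.
\<close>
lemma bdd_below_lagrangian:
  fixes f :: "real^'n \<Rightarrow> real" and G :: "real^'n^'p"
  assumes "0 < \<sigma>" and "strongly_convex \<sigma> f" and "convex U"
    and "is_arg_min (\<lambda>v. lagrangian f G g v x) (\<lambda>v. v \<in> U) u"
  shows "bdd_below ((\<lambda>v. lagrangian f G g v y) ` U)"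
  using lagrangian_ge_tangent[OF assms] by (rule bdd_belowI2)

lemma dual_fun_le_lagrangian:
  fixes f :: "real^'n \<Rightarrow> real" and G :: "real^'n^'p"
  assumes "0 < \<sigma>" and "strongly_convex \<sigma> f" and "convex U"
    and "is_arg_min (\<lambda>v. lagrangian f G g v x) (\<lambda>v. v \<in> U) u" and "v \<in> U"
  shows "dual_fun f G g U y \<le> lagrangian f G g v y"
  unfolding dual_fun_def using bdd_below_lagrangian[OF assms(1-4)] \<open>v \<in> U\<close> by (rule cINF_lower)

lemma dual_fun_le_tangent:
  fixes f :: "real^'n \<Rightarrow> real" and G :: "real^'n^'p"
  assumes "0 < \<sigma>" and "strongly_convex \<sigma> f" and "convex U"
    and min: "is_arg_min (\<lambda>v. lagrangian f G g v x) (\<lambda>v. v \<in> U) u"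
  shows "dual_fun f G g U y \<le> dual_fun f G g U x + (- (G *v u + g)) \<bullet> (y - x)"
proof -
  have "u \<in> U"
    using min by (simp add: is_arg_min_def)
  then have "dual_fun f G g U y \<le> lagrangian f G g u y"
    using assms by (intro dual_fun_le_lagrangian)
  then show ?thesis
    unfolding dual_fun_eq_lagrangian[OF min] lagrangian_change_multiplier[of f G g u y x]
    by (simp only: inner_minus_left)
qed

lemma dual_fun_ge_tangent:
  fixes f :: "real^'n \<Rightarrow> real" and G :: "real^'n^'p"
  assumes "0 < \<sigma>" and "strongly_convex \<sigma> f" and "convex U"
    and min: "is_arg_min (\<lambda>v. lagrangian f G g v x) (\<lambda>v. v \<in> U) u"
  shows "dual_fun f G g U x + (- (G *v u + g)) \<bullet> (y - x)
      - dual_lipschitz \<sigma> G / 2 * (norm (y - x))\<^sup>2 \<le> dual_fun f G g U y"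
  unfolding dual_fun_def[of f G g U y]
proof (rule cINF_greatest)
  show "U \<noteq> {}"
    using min by (auto simp: is_arg_min_def)
qed (rule lagrangian_ge_tangent[OF assms])

lemma grad_dual_fun:
  fixes f :: "real^'n \<Rightarrow> real" and G :: "real^'n^'p"
  assumes "0 < \<sigma>" and "strongly_convex \<sigma> f" and "convex U"
    and "is_arg_min (\<lambda>v. lagrangian f G g v x) (\<lambda>v. v \<in> U) u"
  shows "grad (dual_fun f G g U) x = - (G *v u + g)"
proof (rule grad_eqI, rule GDERIV_of_quadratic_error)
  fix y
  have "0 \<le> dual_lipschitz \<sigma> G / 2 * (norm (y - x))\<^sup>2"
    using \<open>0 < \<sigma>\<close> by (simp add: dual_lipschitz_def)
  then show "\<bar>dual_fun f G g U y - dual_fun f G g U x - - (G *v u + g) \<bullet> (y - x)\<bar>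
      \<le> dual_lipschitz \<sigma> G / 2 * (norm (y - x))\<^sup>2"
    using dual_fun_le_tangent[OF assms, of y] dual_fun_ge_tangent[OF assms, of y] by linarith
qed

section \<open>From dual to primal accuracy\<close>

text \<open>
  For feasible \<open>v\<close> and \<open>x\<close> in the dual cone the constraint term of the Lagrangian is nonpositive, so
  the growth of the Lagrangian away from \<open>u\<close> is at most the duality gap.
\<close>
lemma dist_feasible_le_gap:
  fixes f :: "real^'n \<Rightarrow> real" and G :: "real^'n^'p"
  assumes "strongly_convex \<sigma> f" and "convex U"
    and min: "is_arg_min (\<lambda>v. lagrangian f G g v x) (\<lambda>v. v \<in> U) u"
    and x: "x \<in> dual_cone K" and v: "v \<in> feasible_set G g K U"
  shows "\<sigma> / 2 * (norm (v - u))\<^sup>2 \<le> f v - dual_fun f G g U x"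
proof -
  have "v \<in> U" and "0 \<le> x \<bullet> (G *v v + g)"
    using v x by (auto simp: feasible_set_def intro: dual_cone_inner_nonneg)
  then show ?thesis
    using lagrangian_growth[OF assms(1,2) min, of v] dual_fun_eq_lagrangian[OF min]
    by (simp add: lagrangian_def)
qed

lemma infdist_constraint_le:
  fixes G :: "real^'n^'p"
  assumes "v \<in> feasible_set G g K U"
  shows "infdist (G *v u + g) K \<le> onorm ((*v) G) * norm (v - u)"
proof -
  have "infdist (G *v u + g) K \<le> dist (G *v u + g) (G *v v + g)"
    using assms by (intro infdist_le) (simp add: feasible_set_def)
  also have "\<dots> = norm (G *v (v - u))"
    by (simp add: dist_norm norm_minus_commute matrix_vector_mult_diff_distrib)
  also have "\<dots> \<le> onorm ((*v) G) * norm (v - u)"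
    by (rule norm_matrix_vector_mult_le)
  finally show ?thesis .
qed

text \<open>
  Minimality of \<open>u\<close> compares the two Lagrangians at the same multiplier, so the objective values
  differ by at most the change \<open>x \<bullet> G (u - v)\<close> of the constraint term.
\<close>
lemma arg_min_lagrangian_objective_le:
  fixes G :: "real^'n^'p"
  assumes "is_arg_min (\<lambda>v. lagrangian f G g v x) (\<lambda>v. v \<in> U) u" and "v \<in> U"
  shows "f u \<le> f v + norm x * (onorm ((*v) G) * norm (v - u))"
proof -
  have "lagrangian f G g u x \<le> lagrangian f G g v x"
    using assms by (auto simp: is_arg_min_def not_less)
  then have "f u \<le> f v - x \<bullet> (G *v (v - u))"
    by (simp add: lagrangian_def matrix_vector_mult_diff_distrib inner_add_right inner_diff_right)
  also have "\<dots> \<le> f v + norm x * norm (G *v (v - u))"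
    using Cauchy_Schwarz_ineq2[of x "G *v (v - u)"] by simp
  also have "\<dots> \<le> f v + norm x * (onorm ((*v) G) * norm (v - u))"
    by (intro add_left_mono mult_left_mono norm_matrix_vector_mult_le) simp
  finally show ?thesis .
qed

lemma primal_solution_of_dual_gap:
  fixes f :: "real^'n \<Rightarrow> real" and G :: "real^'n^'p"
  assumes "0 < \<sigma>" and sc: "strongly_convex \<sigma> f" and "convex U"
    and K: "closed K" "K \<noteq> {}"
    and feas: "feasible_set G g K U \<noteq> {}"
    and xs: "xs \<in> dual_cone K" "opt_val f G g K U = dual_fun f G g U xs"
    and min: "is_arg_min (\<lambda>v. lagrangian f G g v x) (\<lambda>v. v \<in> U) u"
    and x: "x \<in> dual_cone K" "norm x \<le> \<rho>" and "norm xs \<le> \<rho>"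
    and \<epsilon>: "0 < \<epsilon>" and gap: "dual_fun f G g U xs - dual_fun f G g U x \<le> \<epsilon>\<^sup>2"
  shows "primal_solution f G g K U (1 + 2 * onorm ((*v) G) / sqrt \<sigma> * (1 + \<rho>)) \<epsilon> u"
proof -
  define N where "N = onorm ((*v) G)"
  define \<delta> where "\<delta> = 2 * N / sqrt \<sigma> * \<epsilon>"
  have N0: "0 \<le> N"
    unfolding N_def by (rule onorm_pos_le) (rule matrix_vector_mul_bounded_linear)
  have \<delta>0: "0 \<le> \<delta>"
    using N0 \<epsilon> \<open>0 < \<sigma>\<close> by (simp add: \<delta>_def)
  have \<rho>0: "0 \<le> \<rho>"
    using x(2) norm_ge_zero order_trans by blast
  have u: "u \<in> U"
    using min by (simp add: is_arg_min_def)
  have "opt_val f G g K U < opt_val f G g K U + Min {\<epsilon>, \<epsilon>\<^sup>2}"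
    using \<epsilon> by simp
  \<comment> \<open>The margin \<open>\<epsilon>\<^sup>2\<close> keeps \<open>v\<close> within order \<open>\<epsilon>\<close> of \<open>u\<close>; the margin \<open>\<epsilon>\<close> is needed for the
    objective value when \<open>\<epsilon> > 1\<close>.\<close>
  then obtain v where v: "v \<in> feasible_set G g K U"
    and fv: "f v < opt_val f G g K U + Min {\<epsilon>, \<epsilon>\<^sup>2}"
    unfolding opt_val_def using cInf_lessD[of "f ` feasible_set G g K U"] feas by blast
  have "\<sigma> / 2 * (norm (v - u))\<^sup>2 \<le> f v - dual_fun f G g U x"
    using dist_feasible_le_gap[OF sc \<open>convex U\<close> min x(1) v] .
  also have "\<dots> \<le> 2 * \<epsilon>\<^sup>2"
    using fv gap xs(2) by simp
  finally have "(norm (v - u))\<^sup>2 \<le> (2 * \<epsilon> / sqrt \<sigma>)\<^sup>2"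
    using \<open>0 < \<sigma>\<close> by (simp add: field_simps)
  then have "norm (v - u) \<le> 2 * \<epsilon> / sqrt \<sigma>"
    using \<epsilon> \<open>0 < \<sigma>\<close> by (auto dest: power2_le_imp_le)
  then have close: "N * norm (v - u) \<le> \<delta>"
    using mult_left_mono[OF _ N0, of "norm (v - u)" "2 * \<epsilon> / sqrt \<sigma>"]
    by (simp add: \<delta>_def mult.assoc mult.left_commute)
  have dist: "infdist (G *v u + g) K \<le> \<delta>"
    using infdist_constraint_le[OF v, of u] close by (simp add: N_def)
  have "norm xs * infdist (G *v u + g) K \<le> \<rho> * \<delta>"
    using \<open>norm xs \<le> \<rho>\<close> dist \<rho>0 by (intro mult_mono infdist_nonneg)
  moreover have "dual_fun f G g U xs \<le> f u - xs \<bullet> (G *v u + g)"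
    using dual_fun_le_lagrangian[OF \<open>0 < \<sigma>\<close> sc \<open>convex U\<close> min u, of xs] by (simp add: lagrangian_def)
  ultimately have lower: "- (\<rho> * \<delta>) \<le> f u - opt_val f G g K U"
    using dual_cone_inner_ge_infdist[OF xs(1) K, of "G *v u + g"] xs(2) by linarith
  have "norm x * (N * norm (v - u)) \<le> \<rho> * \<delta>"
    using x(2) close \<rho>0 N0 by (intro mult_mono) auto
  moreover have "v \<in> U"
    using v by (simp add: feasible_set_def)
  ultimately have upper: "f u - opt_val f G g K U \<le> \<epsilon> + \<rho> * \<delta>"
    using arg_min_lagrangian_objective_le[OF min, of v] fv by (simp add: N_def)
  have "(1 + 2 * onorm ((*v) G) / sqrt \<sigma> * (1 + \<rho>)) * \<epsilon> = \<epsilon> + \<delta> + \<rho> * \<delta>"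
    by (simp add: \<delta>_def N_def algebra_simps add_divide_distrib)
  then show ?thesis
    using u dist lower upper \<epsilon> \<delta>0 mult_nonneg_nonneg[OF \<rho>0 \<delta>0]
    unfolding primal_solution_def by simp
qed

section \<open>Complexity of the last primal iterate\<close>

theorem theorem3p3:
  fixes f :: "real^'n \<Rightarrow> real" and G :: "real^'n^'p" and g :: "real^'p"
    and K :: "(real^'p) set" and U :: "(real^'n) set"
    and \<sigma> LG :: real and x0 :: "real^'p"
  assumes "\<sigma> > 0" and "strongly_convex \<sigma> f"
    and "G \<noteq> 0"
    and "proper_cone K"
    and "U \<noteq> {}" and "closed U" and "convex U"
    and "feasible_set G g K U \<noteq> {}"
    and "\<exists>xs\<in>dual_solutions f G g K U. opt_val f G g K U = dual_fun f G g U xs"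
    and "LG \<ge> dual_lipschitz \<sigma> G"
    and "x0 \<in> dual_cone K"
  shows "\<exists>C1>0. \<exists>C2>0. \<forall>\<alpha> x u. DG_iterates f \<sigma> G g K U LG x0 \<alpha> x u \<longrightarrow>
           (\<forall>\<epsilon>>0. \<forall>k\<ge>1. real k \<ge> C1 / \<epsilon>\<^sup>2 \<longrightarrow> primal_solution f G g K U C2 \<epsilon> (u k))"
proof -
  obtain xs where xs: "xs \<in> dual_cone K" "opt_val f G g K U = dual_fun f G g U xs"
    and max: "\<And>y. y \<in> dual_cone K \<Longrightarrow> dual_fun f G g U y \<le> dual_fun f G g U xs"
    using assms(9) by (auto simp: dual_solutions_def is_arg_max_def not_less)
  have K: "closed K" "K \<noteq> {}"
    using \<open>proper_cone K\<close> by (auto simp: proper_cone_def)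
  have L: "0 < dual_lipschitz \<sigma> G"
    using assms(1,3) by (rule dual_lipschitz_pos)
  then have LG: "0 < LG"
    using assms(10) by simp
  define R where "R = norm (xs - x0)"
  \<comment> \<open>\<open>\<rho>\<close> bounds all dual iterates, which never move away from \<open>xs\<close>; the summand \<open>1\<close> in \<open>C1\<close>
    covers a start at the maximizer.\<close>
  define \<rho> where "\<rho> = norm xs + R"
  define C1 where "C1 = LG / 2 * R\<^sup>2 + 1"
  define C2 where "C2 = 1 + 2 * onorm ((*v) G) / sqrt \<sigma> * (1 + \<rho>)"
  have "0 < C1"
    unfolding C1_def using LG by (intro add_nonneg_pos) auto
  moreover have "0 < C2"
    unfolding C2_def using \<open>\<sigma> > 0\<close> onorm_pos_le[OF matrix_vector_mul_bounded_linear[of G]]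
    by (intro add_pos_nonneg) (auto simp: \<rho>_def R_def)
  moreover have "primal_solution f G g K U C2 \<epsilon> (u k)"
    if DG: "DG_iterates f \<sigma> G g K U LG x0 \<alpha> x u"
      and \<epsilon>: "0 < \<epsilon>" and k: "1 \<le> k" "C1 / \<epsilon>\<^sup>2 \<le> real k" for \<alpha> x u \<epsilon> k
  proof -
    have init: "x 0 = x0"
      and \<alpha>: "\<And>k. 1 / LG \<le> \<alpha> k" "\<And>k. \<alpha> k \<le> 1 / dual_lipschitz \<sigma> G"
      and min: "\<And>k. is_arg_min (\<lambda>v. lagrangian f G g v (x k)) (\<lambda>v. v \<in> U) (u k)"
      and step: "\<And>k. x (Suc k)
        = closest_point (dual_cone K) (x k + \<alpha> k *\<^sub>R grad (dual_fun f G g U) (x k))"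
      using DG unfolding DG_iterates_def by auto
    have \<alpha>L: "\<alpha> k * dual_lipschitz \<sigma> G \<le> 1" for k
      using \<alpha>(2)[of k] L by (simp add: field_simps)
    have x0_in: "x 0 \<in> dual_cone K"
      using init assms(11) by simp
    note dual = \<open>\<sigma> > 0\<close> \<open>strongly_convex \<sigma> f\<close> \<open>convex U\<close> min
    note rate = projected_ascent_rate[where d = "dual_fun f G g U" and x = x
        and s = "\<lambda>k. - (G *v u k + g)", OF closed_dual_cone convex_dual_cone x0_in \<alpha>(1) \<alpha>L LG
        step[unfolded grad_dual_fun[OF dual]] dual_fun_le_tangent[OF dual] dual_fun_ge_tangent[OF dual]
        xs(1) max, of k]
    have "norm (x k) \<le> \<rho>"
      using rate(2) norm_triangle_sub[of "x k" xs]
      by (simp add: \<rho>_def R_def init norm_minus_commute)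
    moreover have "norm xs \<le> \<rho>"
      by (simp add: \<rho>_def R_def)
    moreover have "dual_fun f G g U xs - dual_fun f G g U (x k) \<le> \<epsilon>\<^sup>2"
    proof -
      have "real k * (dual_fun f G g U xs - dual_fun f G g U (x k)) \<le> C1"
        using rate(3) by (simp add: C1_def R_def init)
      also have "\<dots> \<le> real k * \<epsilon>\<^sup>2"
        using k(2) \<epsilon> by (simp add: field_simps)
      finally show ?thesis
        using k(1) by simp
    qed
    ultimately show ?thesis
      unfolding C2_def
      using primal_solution_of_dual_gap[OF assms(1,2,7) K assms(8) xs min rate(1)] \<epsilon> by blast
  qed
  ultimately show ?thesis
    by blast
qed

end
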